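(* Let $\mathbb{K}$ be a field of characteristic zero. The triples $(\varphi,\psi,\rho)$ of formal series in $\mathbb{K}[[t]]$ satisfying $$\varphi(t)\,\frac{\psi(t+u)-\psi(u)}{t}+\frac{\varphi(t+u)-\varphi(t)}{u}\,\psi(u)=\rho(t+u)$$ in $\mathbb{K}[[t,u]]$ and $\varphi(0)\psi(0)=0$ are exactly the following: (i) $(\varphi(t),\psi(t),\rho(t))=(\varphi(t),\,ct,\,c\varphi(t))$ with $c\in\mathbb{K}$, $\varphi\in\mathbb{K}[[t]]$; (ii) $(\varphi(t),\psi(t),\rho(t))=(ct,\,\psi(t),\,c\psi(t))$ with $c\in\mathbb{K}$, $\psi\in\mathbb{K}[[t]]$.
   Context: $t,u$ are commuting variables. No further notation is needed. *)

theory Defs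
  imports "HOL-Computational_Algebra.Formal_Power_Series"
begin

unbundle fps_syntax

text \<open>
  \<open>\<bbbK>[[t,u]]\<close> is represented as \<open>\<bbbK>[[t]][[u]]\<close>, i.e. as the type \<^typ>\<open>'a fps fps\<close>:
  the outer variable is \<open>u\<close>, and the coefficient of \<open>t\<^sup>i u\<^sup>j\<close> in \<open>F\<close> is \<open>F $ j $ i\<close>.
\<close>

definition var_t :: "'a::comm_ring_1 fps fps" where
  "var_t = fps_const fps_X"

definition var_u :: "'a::comm_ring_1 fps fps" where
  "var_u = fps_X"

text \<open>
  Substitution \<open>f(g) = (\<Sum>n. f\<^sub>n g\<^sup>n)\<close> of a bivariate series \<open>g\<close> without constant term into a
  univariate series \<open>f\<close>. As \<open>g\<^sup>n\<close> has no terms of total degree below \<open>n\<close>, only the indices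
  \<open>n \<le> i + j\<close> contribute to the coefficient of \<open>t\<^sup>i u\<^sup>j\<close>. The library's \<^const>\<open>fps_compose\<close> on
  \<^typ>\<open>'a fps fps\<close> is unsuitable: it requires \<open>g $ 0 = 0\<close>, which fails for \<open>g = t + u\<close>.
\<close>

definition subst2 :: "'a::comm_ring_1 fps \<Rightarrow> 'a fps fps \<Rightarrow> 'a fps fps" where
  "subst2 f g = Abs_fps (\<lambda>j. Abs_fps (\<lambda>i. \<Sum>n\<le>i + j. f $ n * (g ^ n) $ j $ i))"

text \<open>
  The quotient \<open>a / b\<close> inside the ring itself, for \<open>b\<close> a nonzero divisor of \<open>a\<close>. Library division
  on \<^typ>\<open>'a fps fps\<close> does not compute quotients by \<open>t\<close>, since \<open>t\<close> is a non-invertible constant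
  with respect to \<open>u\<close>.
\<close>

definition exact_quot :: "'a::idom \<Rightarrow> 'a \<Rightarrow> 'a" where
  "exact_quot a b = (THE q. q * b = a)"

lemma exact_quot_mult:
  fixes a b :: "'a::idom"
  assumes "b dvd a" "b \<noteq> 0"
  shows "exact_quot a b * b = a"
proof -
  from assms(1) obtain q where q: "q * b = a"
    by (metis dvdE mult.commute)
  have "exact_quot a b = q"
    unfolding exact_quot_def using q assms(2) by (intro the_equality) auto
  with q show ?thesis by simp
qed

lemma var_t_nonzero: "var_t \<noteq> (0 :: 'a::comm_ring_1 fps fps)"
  by (simp add: var_t_def)

lemma var_u_nonzero: "var_u \<noteq> (0 :: 'a::comm_ring_1 fps fps)"
  by (simp add: var_u_def)

lemma subst2_var_t_nth: "subst2 f var_t $ j $ i = (if j = 0 then f $ i else 0)"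
  by (simp add: subst2_def var_t_def fps_const_power fps_X_power_iff if_distrib
      sum.delta cong: if_cong)

lemma subst2_var_u_nth: "subst2 f var_u $ j $ i = (if i = 0 then f $ j else 0)"
proof -
  have "(\<Sum>n\<le>i + j. f $ n * (fps_X ^ n :: 'a fps fps) $ j $ i)
      = (\<Sum>n\<le>i + j. if n = j then (if i = 0 then f $ j else 0) else 0)"
    by (intro sum.cong) (auto simp: fps_X_power_iff)
  then show ?thesis
    by (simp add: subst2_def var_u_def)
qed

lemma var_add_power_nth:
  "((var_t + var_u :: 'a::comm_ring_1 fps fps) ^ n) $ j $ i
    = (if n = i + j then of_nat (n choose i) else 0)"
proof -
  have "((var_t + var_u :: 'a fps fps) ^ n) $ j $ i
      = (\<Sum>k\<le>n. (of_nat (n choose k) * var_t ^ k * var_u ^ (n - k) :: 'a fps fps) $ j $ i)"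
    by (simp add: binomial_ring fps_sum_nth)
  also have "\<dots> = (\<Sum>k\<le>n. if k = i then (if n = i + j then of_nat (n choose i) else 0) else 0)"
  proof (intro sum.cong refl)
    fix k assume "k \<in> {..n}"
    have "(of_nat (n choose k) * var_t ^ k * var_u ^ (n - k) :: 'a fps fps)
        = fps_const (of_nat (n choose k) * fps_X ^ k) * fps_X ^ (n - k)"
      by (simp only: var_t_def var_u_def fps_const_power fps_of_nat[symmetric] fps_const_mult)
    then have "(of_nat (n choose k) * var_t ^ k * var_u ^ (n - k) :: 'a fps fps) $ j $ i
        = (if j = n - k \<and> i = k then of_nat (n choose k) else 0)"
      by (simp add: fps_X_power_mult_right_nth)
    with \<open>k \<in> {..n}\<close> show "(of_nat (n choose k) * var_t ^ k * var_u ^ (n - k) :: 'a fps fps) $ j $ i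
        = (if k = i then (if n = i + j then of_nat (n choose i) else 0) else 0)"
      by auto
  qed
  also have "\<dots> = (if n = i + j then of_nat (n choose i) else 0)"
    by auto
  finally show ?thesis .
qed

lemma subst2_var_add_nth:
  "subst2 f (var_t + var_u) $ j $ i = of_nat ((i + j) choose i) * f $ (i + j)"
  by (simp add: subst2_def var_add_power_nth if_distrib mult.commute cong: if_cong)

lemma var_t_dvd: "var_t dvd subst2 (f :: 'a::comm_ring_1 fps) (var_t + var_u) - subst2 f var_u"
proof
  let ?d = "subst2 f (var_t + var_u) - subst2 f var_u"
  show "?d = var_t * Abs_fps (\<lambda>j. fps_shift 1 (?d $ j))"
  proof (intro fps_ext)
    fix j i
    have "(var_t * F) $ j $ i = (if i = 0 then 0 else F $ j $ (i - 1))" for F :: "'a fps fps"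
      by (simp add: var_t_def)
    then show "?d $ j $ i = (var_t * Abs_fps (\<lambda>j. fps_shift 1 (?d $ j))) $ j $ i"
      by (cases i) (simp_all add: subst2_var_add_nth subst2_var_u_nth)
  qed
qed

lemma var_u_dvd: "var_u dvd subst2 (f :: 'a::comm_ring_1 fps) (var_t + var_u) - subst2 f var_t"
proof
  let ?d = "subst2 f (var_t + var_u) - subst2 f var_t"
  show "?d = var_u * fps_shift 1 ?d"
  proof (intro fps_ext)
    fix j i
    have "(var_u * F) $ j $ i = (if j = 0 then 0 else F $ (j - 1) $ i)" for F :: "'a fps fps"
      by (simp add: var_u_def)
    then show "?d $ j $ i = (var_u * fps_shift 1 ?d) $ j $ i"
      by (cases j) (simp_all add: subst2_var_add_nth subst2_var_t_nth del: fps_mult_nth_0)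
  qed
qed

end

(*
  Comparing the parts of the equation with u = 0 and with t = 0 gives two formulas for rho,
  whose comparison yields psi(0) (t phi' - phi) = phi(0) (t psi' - psi). If exactly one of phi(0),
  psi(0) vanishes, the corresponding series is therefore linear, and the formulas give rho.
  If both vanish, write phi = t f and psi = t g; then t rho = phi psi, and the equation becomes
  (f(t+u) - f(t)) (g(t+u) - g(u)) = 0. As K[[t,u]] is an integral domain, f or g is constant.
*)

theory Submission
  imports Defs
begin

section \<open>Substitution into formal power series\<close>

lemma subst2_fps_const_mult:
  "subst2 (fps_const c * f) v = fps_const (fps_const c) * subst2 f v"
  by (simp add: fps_eq_iff subst2_def sum_distrib_left mult.assoc)

lemma subst2_fps_X:
  assumes "v $ 0 $ 0 = 0"
  shows "subst2 fps_X v = v"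
proof (intro fps_ext)
  fix j i
  have "subst2 fps_X v $ j $ i = (\<Sum>n\<le>i + j. if n = 1 then v $ j $ i else 0)"
    unfolding subst2_def fps_nth_Abs_fps by (intro sum.cong) (auto simp: fps_X_def)
  \<comment> \<open>For \<open>i = j = 0\<close> the range of summation misses \<open>n = 1\<close>,
    so the sum is 0, which the assumption on \<open>v\<close> matches.\<close>
  also have "\<dots> = v $ j $ i"
    using assms by (cases "i + j") auto
  finally show "subst2 fps_X v $ j $ i = v $ j $ i" .
qed

lemma subst2_var_t: "subst2 f var_t = fps_const f"
  by (simp add: fps_eq_iff subst2_var_t_nth)

lemma subst2_fps_X_mult_var_u:
  fixes f :: "'a::comm_ring_1 fps"
  shows "subst2 (fps_X * f) var_u = var_u * subst2 f var_u"
proof (intro fps_ext)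
  fix j i
  have "(var_u * F) $ j $ i = (if j = 0 then 0 else F $ (j - 1) $ i)" for F :: "'a fps fps"
    by (simp add: var_u_def)
  then show "subst2 (fps_X * f) var_u $ j $ i = (var_u * subst2 f var_u) $ j $ i"
    by (cases j) (simp_all add: subst2_var_u_nth del: fps_mult_nth_0)
qed

lemma var_add_mult_nth:
  "((var_t + var_u) * F) $ j $ i
    = (if i = 0 then 0 else F $ j $ (i - 1)) + (if j = 0 then 0 else F $ (j - 1) $ i)"
  by (simp add: distrib_right var_t_def var_u_def)

text \<open>On coefficients this is Pascal's rule for \<open>(i + j) choose i\<close>.\<close>

lemma subst2_fps_X_mult_var_add:
  "subst2 (fps_X * f) (var_t + var_u) = (var_t + var_u) * subst2 f (var_t + var_u)"
proof (intro fps_ext)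
  fix j i
  show "subst2 (fps_X * f) (var_t + var_u) $ j $ i
      = ((var_t + var_u) * subst2 f (var_t + var_u)) $ j $ i"
    unfolding var_add_mult_nth
    by (cases i; cases j) (simp_all add: subst2_var_add_nth algebra_simps)
qed

lemma subst2_const_add_fps_X_mult_var_add:
  "subst2 (fps_const c + fps_X * f) (var_t + var_u)
    = fps_const (fps_const c) + (var_t + var_u) * subst2 f (var_t + var_u)"
  unfolding subst2_fps_X_mult_var_add[symmetric]
  by (intro fps_ext) (auto simp: subst2_var_add_nth algebra_simps)

lemma fps_decompose:
  fixes f :: "'a::comm_ring_1 fps"
  shows "f = fps_const (f $ 0) + fps_X * fps_shift 1 f"
proof (intro fps_ext)
  fix n
  show "f $ n = (fps_const (f $ 0) + fps_X * fps_shift 1 f) $ n"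
    by (cases n) simp_all
qed

text \<open>The defect \<open>H f\<close> of multiplicativity kills the constant term of
  \<open>f\<close>, hence \<open>H f\<close> is \<open>t + u\<close> times the defect of the shifted
  series. Iterating makes it divisible by every power of \<open>t + u\<close>, so it
  vanishes.\<close>

lemma subst2_mult_var_add:
  "subst2 (f * g) (var_t + var_u) = subst2 f (var_t + var_u) * subst2 g (var_t + var_u)"
proof -
  define H where "H f = subst2 (f * g) (var_t + var_u)
    - subst2 f (var_t + var_u) * subst2 g (var_t + var_u)" for f
  have H_step: "H f = (var_t + var_u) * H (fps_shift 1 f)" for f
  proof -
    let ?s = "var_t + var_u" and ?f = "fps_shift 1 f"
    have "f * g = fps_const (f $ 0) * g + fps_X * (?f * g)"
      using arg_cong[OF fps_decompose[of f], of "\<lambda>h. h * g"]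
      by (simp only: distrib_right mult.assoc)
    then have "subst2 (f * g) ?s
        = fps_const (fps_const (f $ 0)) * subst2 g ?s + ?s * subst2 (?f * g) ?s"
      unfolding subst2_fps_const_mult[symmetric] subst2_fps_X_mult_var_add[symmetric]
      by (intro fps_ext) (simp add: subst2_var_add_nth algebra_simps)
    moreover have "subst2 f ?s = fps_const (fps_const (f $ 0)) + ?s * subst2 ?f ?s"
      using arg_cong[OF fps_decompose[of f], of "\<lambda>h. subst2 h ?s"]
      unfolding subst2_const_add_fps_X_mult_var_add .
    ultimately show ?thesis
      by (simp add: H_def algebra_simps)
  qed
  have "H f $ j $ i = 0" for j i
  \<comment> \<open>Multiplication by \<open>t + u\<close> raises the total degree by one, so
    \<open>H_step\<close> reduces each coefficient to coefficients of total degree one less. It also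
    replaces \<open>f\<close> by its shift, hence the generalisation over \<open>f\<close>.\<close>
  proof (induction "i + j" arbitrary: f i j)
    case 0
    then show ?case by (subst H_step) (simp add: var_add_mult_nth del: fps_mult_nth_0)
  next
    case (Suc n)
    then show ?case by (subst H_step) (auto simp: var_add_mult_nth simp del: fps_mult_nth_0)
  qed
  then have "H f = 0"
    by (simp add: fps_eq_iff)
  then show ?thesis
    by (simp add: H_def)
qed

section \<open>Coefficients of the difference quotients\<close>

lemma exact_quot_var_t:
  fixes f :: "'a::idom fps"
  shows "exact_quot (subst2 f (var_t + var_u) - subst2 f var_u) var_t $ j $ i
    = of_nat (Suc (i + j) choose Suc i) * f $ Suc (i + j)"
proof -
  let ?d = "subst2 f (var_t + var_u) - subst2 f var_u"
  \<comment> \<open>Multiplying by t moves the wanted coefficient to index \<open>Suc i\<close>,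
    where the subtracted series in u alone contributes nothing.\<close>
  have "(exact_quot ?d var_t * var_t) $ j $ Suc i = ?d $ j $ Suc i"
    by (simp only: exact_quot_mult[OF var_t_dvd var_t_nonzero])
  then show ?thesis
    by (simp add: var_t_def[symmetric] subst2_var_add_nth subst2_var_u_nth)
       (simp add: var_t_def)
qed

lemma exact_quot_var_u:
  fixes f :: "'a::idom fps"
  shows "exact_quot (subst2 f (var_t + var_u) - subst2 f var_t) var_u $ j $ i
    = of_nat (Suc (i + j) choose i) * f $ Suc (i + j)"
proof -
  let ?d = "subst2 f (var_t + var_u) - subst2 f var_t"
  have "(exact_quot ?d var_u * var_u) $ Suc j $ i = ?d $ Suc j $ i"
    by (simp only: exact_quot_mult[OF var_u_dvd var_u_nonzero])
  then show ?thesis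
    by (simp add: subst2_var_add_nth subst2_var_t_nth del: fps_mult_nth_0)
       (simp add: var_u_def)
qed

section \<open>Criteria for linear and constant series\<close>

lemma fps_linearI:
  fixes f :: "'a::field_char_0 fps"
  assumes "fps_X * fps_deriv f = f"
  shows "f = fps_const (f $ 1) * fps_X"
proof (intro fps_ext)
  fix n
  \<comment> \<open>The Euler operator multiplies the n-th coefficient by n; in characteristic zero
    only n = 1 is a fixed factor.\<close>
  have "of_nat n * f $ n = f $ n"
    using arg_cong[OF assms, of "\<lambda>h. h $ n"] by (cases n) simp_all
  then have "f $ n = 0 \<or> n = 1"
    by (metis mult_cancel_right1 of_nat_eq_1_iff)
  then show "f $ n = (fps_const (f $ 1) * fps_X) $ n"
    by (auto simp: fps_X_def)
qed

text \<open>The coefficient of the pure power u^n is \<open>f $ n\<close> on the left, and 0 on the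
  right as soon as n > 0.\<close>

lemma const_if_subst2_var_add_eq_var_t:
  fixes f :: "'a::field_char_0 fps"
  assumes "subst2 f (var_t + var_u) = subst2 f var_t"
  shows "f = fps_const (f $ 0)"
proof (intro fps_ext)
  fix n
  have "subst2 f (var_t + var_u) $ n $ 0 = subst2 f var_t $ n $ 0"
    using assms by simp
  then show "f $ n = fps_const (f $ 0) $ n"
    by (auto simp: subst2_var_add_nth subst2_var_t_nth split: if_splits)
qed

lemma const_if_subst2_var_add_eq_var_u:
  fixes f :: "'a::field_char_0 fps"
  assumes "subst2 f (var_t + var_u) = subst2 f var_u"
  shows "f = fps_const (f $ 0)"
proof (intro fps_ext)
  fix n
  have "subst2 f (var_t + var_u) $ 0 $ n = subst2 f var_u $ 0 $ n"
    using assms by simp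
  then show "f $ n = fps_const (f $ 0) $ n"
    by (auto simp: subst2_var_add_nth subst2_var_u_nth split: if_splits)
qed

section \<open>The functional equation and its specialisations\<close>

definition functional_eq :: "'a::idom fps \<Rightarrow> 'a fps \<Rightarrow> 'a fps \<Rightarrow> bool" where
  "functional_eq \<phi> \<psi> \<rho> \<longleftrightarrow>
    subst2 \<phi> var_t * exact_quot (subst2 \<psi> (var_t + var_u) - subst2 \<psi> var_u) var_t
    + exact_quot (subst2 \<phi> (var_t + var_u) - subst2 \<phi> var_t) var_u * subst2 \<psi> var_u
      = subst2 \<rho> (var_t + var_u)"

lemma functional_eq_cleared:
  fixes \<phi> :: "'a::idom fps"
  assumes "functional_eq \<phi> \<psi> \<rho>"
  shows "var_u * subst2 \<phi> var_t * (subst2 \<psi> (var_t + var_u) - subst2 \<psi> var_u)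
    + var_t * (subst2 \<phi> (var_t + var_u) - subst2 \<phi> var_t) * subst2 \<psi> var_u
      = var_t * var_u * subst2 \<rho> (var_t + var_u)"
proof -
  define q where "q = exact_quot (subst2 \<psi> (var_t + var_u) - subst2 \<psi> var_u) var_t"
  define p where "p = exact_quot (subst2 \<phi> (var_t + var_u) - subst2 \<phi> var_t) var_u"
  have "q * var_t = subst2 \<psi> (var_t + var_u) - subst2 \<psi> var_u"
    unfolding q_def by (rule exact_quot_mult[OF var_t_dvd var_t_nonzero])
  moreover have "p * var_u = subst2 \<phi> (var_t + var_u) - subst2 \<phi> var_t"
    unfolding p_def by (rule exact_quot_mult[OF var_u_dvd var_u_nonzero])
  moreover have "subst2 \<phi> var_t * q + p * subst2 \<psi> var_u = subst2 \<rho> (var_t + var_u)"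
    using assms by (simp only: functional_eq_def q_def p_def)
  ultimately show ?thesis
    by algebra
qed

text \<open>Since u is the outer variable, setting u = 0 means taking coefficient 0. The first
  quotient becomes (\<psi>(t) - \<psi>(0))/t, the second the derivative of \<phi>.\<close>

lemma functional_eq_at_u_0:
  fixes \<phi> :: "'a::idom fps"
  assumes "functional_eq \<phi> \<psi> \<rho>"
  shows "\<phi> * fps_shift 1 \<psi> + fps_const (\<psi> $ 0) * fps_deriv \<phi> = \<rho>"
proof -
  let ?Q = "exact_quot (subst2 \<psi> (var_t + var_u) - subst2 \<psi> var_u) var_t"
  let ?P = "exact_quot (subst2 \<phi> (var_t + var_u) - subst2 \<phi> var_t) var_u"
  have "?Q $ 0 = fps_shift 1 \<psi>"
    by (intro fps_ext) (simp add: exact_quot_var_t)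
  moreover have "?P $ 0 = fps_deriv \<phi>"
    by (intro fps_ext) (simp add: exact_quot_var_u)
  moreover have "subst2 \<psi> var_u $ 0 = fps_const (\<psi> $ 0)"
    by (intro fps_ext) (simp add: subst2_var_u_nth)
  moreover have "subst2 \<rho> (var_t + var_u) $ 0 = \<rho>"
    by (intro fps_ext) (simp add: subst2_var_add_nth)
  moreover have "(subst2 \<phi> var_t * ?Q + ?P * subst2 \<psi> var_u) $ 0
      = subst2 \<rho> (var_t + var_u) $ 0"
    using assms by (simp only: functional_eq_def)
  ultimately show ?thesis
    by (simp add: subst2_var_t mult.commute)
qed

lemma functional_eq_at_t_0:
  fixes \<phi> :: "'a::idom fps"
  assumes "functional_eq \<phi> \<psi> \<rho>"
  shows "fps_const (\<phi> $ 0) * fps_deriv \<psi> + fps_shift 1 \<phi> * \<psi> = \<rho>"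
proof -
  \<comment> \<open>\<open>E\<close> is the specialisation t = 0. As t is the inner variable, it
    acts on each coefficient in u separately.\<close>
  define E :: "'a fps fps \<Rightarrow> 'a fps" where "E F = Abs_fps (\<lambda>j. F $ j $ 0)" for F
  have E_add: "E (F + G) = E F + E G" for F G
    by (intro fps_ext) (simp add: E_def)
  have E_mult: "E (F * G) = E F * E G" for F G
    by (intro fps_ext) (simp add: E_def fps_mult_nth fps_sum_nth)
  let ?Q = "exact_quot (subst2 \<psi> (var_t + var_u) - subst2 \<psi> var_u) var_t"
  let ?P = "exact_quot (subst2 \<phi> (var_t + var_u) - subst2 \<phi> var_t) var_u"
  have "E (subst2 \<phi> var_t) = fps_const (\<phi> $ 0)"
    by (intro fps_ext) (simp add: E_def subst2_var_t_nth)
  moreover have "E ?Q = fps_deriv \<psi>"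
    by (intro fps_ext) (simp add: E_def exact_quot_var_t)
  moreover have "E ?P = fps_shift 1 \<phi>"
    by (intro fps_ext) (simp add: E_def exact_quot_var_u)
  moreover have "E (subst2 \<psi> var_u) = \<psi>"
    by (intro fps_ext) (simp add: E_def subst2_var_u_nth)
  moreover have "E (subst2 \<rho> (var_t + var_u)) = \<rho>"
    by (intro fps_ext) (simp add: E_def subst2_var_add_nth)
  moreover have "E (subst2 \<phi> var_t * ?Q + ?P * subst2 \<psi> var_u) = E (subst2 \<rho> (var_t + var_u))"
    using assms by (simp only: functional_eq_def)
  ultimately show ?thesis
    by (simp add: E_add E_mult)
qed

lemma functional_eq_euler:
  fixes \<phi> :: "'a::idom fps"
  assumes "functional_eq \<phi> \<psi> \<rho>"
  shows "fps_const (\<psi> $ 0) * (fps_X * fps_deriv \<phi> - \<phi>)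
    = fps_const (\<phi> $ 0) * (fps_X * fps_deriv \<psi> - \<psi>)"
proof -
  have shift: "fps_X * fps_shift 1 f = f - fps_const (f $ 0)" for f :: "'a fps"
    using fps_decompose[of f] by (simp add: algebra_simps)
  \<comment> \<open>The two formulas for \<rho> are equated and multiplied by \<open>fps_X\<close>,
    which turns each shift into a series minus its constant term. The product \<phi>\<psi> then
    occurs on both sides and cancels.\<close>
  have "\<phi> * (fps_X * fps_shift 1 \<psi>) + fps_const (\<psi> $ 0) * (fps_X * fps_deriv \<phi>)
      = fps_const (\<phi> $ 0) * (fps_X * fps_deriv \<psi>) + (fps_X * fps_shift 1 \<phi>) * \<psi>"
    using arg_cong[OF trans[OF functional_eq_at_u_0[OF assms] functional_eq_at_t_0[OF assms, symmetric]],
        of "\<lambda>h. fps_X * h"]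
    by (simp add: algebra_simps)
  then show ?thesis
    unfolding shift by (simp add: algebra_simps)
qed

section \<open>Linearity of one of the two series\<close>

lemma functional_eq_linear_cases:
  fixes \<phi> :: "'a::field_char_0 fps"
  assumes eq: "functional_eq \<phi> \<psi> \<rho>" and "\<phi> $ 0 * \<psi> $ 0 = 0"
  obtains c where "\<psi> = fps_const c * fps_X" | c where "\<phi> = fps_const c * fps_X"
proof -
  consider (left) "\<phi> $ 0 = 0" "\<psi> $ 0 \<noteq> 0" | (right) "\<phi> $ 0 \<noteq> 0" "\<psi> $ 0 = 0"
    | (both) "\<phi> $ 0 = 0" "\<psi> $ 0 = 0"
    using assms(2) by auto
  then show thesis
  proof cases
    case left
    \<comment> \<open>One side of the Euler relation is zero, and the nonzero constant \<psi>(0)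
      cancels from the other.\<close>
    then have "fps_X * fps_deriv \<phi> = \<phi>"
      using functional_eq_euler[OF eq] by auto
    then show thesis using fps_linearI that(2) by blast
  next
    case right
    then have "fps_X * fps_deriv \<psi> = \<psi>"
      using functional_eq_euler[OF eq] by auto
    then show thesis using fps_linearI that(1) by blast
  next
    case both
    define f g where "f = fps_shift 1 \<phi>" and "g = fps_shift 1 \<psi>"
    have \<phi>: "\<phi> = fps_X * f" and \<psi>: "\<psi> = fps_X * g"
      using fps_decompose[of \<phi>] fps_decompose[of \<psi>] both by (simp_all add: f_def g_def)
    have \<rho>: "\<rho> = fps_X * (f * g)"
      using functional_eq_at_u_0[OF eq] unfolding both(2) g_def[symmetric]
      by (simp add: \<phi> mult.assoc)
    define F G a b where "F = subst2 f (var_t + var_u)" and "G = subst2 g (var_t + var_u)"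
      and "a = subst2 f var_t" and "b = subst2 g var_u"
    have at: "subst2 \<phi> var_t = var_t * a"
      unfolding \<phi> a_def subst2_var_t by (simp add: var_t_def)
    have "var_u * (var_t * a) * ((var_t + var_u) * G - var_u * b)
        + var_t * ((var_t + var_u) * F - var_t * a) * (var_u * b)
        = var_t * var_u * ((var_t + var_u) * (F * G))"
      using functional_eq_cleared[OF eq] unfolding at
      unfolding \<phi> \<psi> \<rho> subst2_fps_X_mult_var_add subst2_fps_X_mult_var_u
        F_def G_def b_def
      unfolding subst2_mult_var_add .
    \<comment> \<open>The two terms in a b on the left combine to -(t + u) a b, so t u (t + u)
      factors out of the whole equation. What remains is a G + F b - a b = F G, that is, (F - a)(G -
      b) = 0.\<close>
    then have "var_t * var_u * (var_t + var_u) * ((F - a) * (G - b)) = 0"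
      by algebra
    moreover have "(var_t + var_u :: 'a fps fps) \<noteq> 0"
    proof
      assume "(var_t + var_u :: 'a fps fps) = 0"
      then have "(var_t + var_u :: 'a fps fps) $ 1 $ 0 = 0" by simp
      then show False by (simp add: var_t_def var_u_def)
    qed
    ultimately have "F = a \<or> G = b"
      by (simp add: var_t_nonzero var_u_nonzero)
    then show thesis
    proof
      assume "F = a"
      then have "f = fps_const (f $ 0)"
        unfolding F_def a_def by (rule const_if_subst2_var_add_eq_var_t)
      then show thesis using that(2) \<phi> by (metis mult.commute)
    next
      assume "G = b"
      then have "g = fps_const (g $ 0)"
        unfolding G_def b_def by (rule const_if_subst2_var_add_eq_var_u)
      then show thesis using that(1) \<psi> by (metis mult.commute)
    qed
  qed
qed

section \<open>The two families solve the equation\<close>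

lemma subst2_linear:
  "subst2 (fps_const c * fps_X) var_t = fps_const (fps_const c) * var_t"
  "subst2 (fps_const c * fps_X) var_u = fps_const (fps_const c) * var_u"
  "subst2 (fps_const c * fps_X) (var_t + var_u) = fps_const (fps_const c) * (var_t + var_u)"
  unfolding subst2_fps_const_mult
  by (simp_all add: subst2_fps_X var_t_def var_u_def)

lemma functional_eq_linear_right:
  fixes \<phi> :: "'a::idom fps"
  shows "functional_eq \<phi> (fps_const c * fps_X) (fps_const c * \<phi>)"
proof -
  let ?C = "fps_const (fps_const c) :: 'a fps fps"
  let ?q = "exact_quot (subst2 (fps_const c * fps_X) (var_t + var_u)
    - subst2 (fps_const c * fps_X) var_u) (var_t :: 'a fps fps)"
  let ?p = "exact_quot (subst2 \<phi> (var_t + var_u) - subst2 \<phi> var_t) var_u"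
  have "?q * var_t = ?C * var_t"
    unfolding exact_quot_mult[OF var_t_dvd var_t_nonzero]
    unfolding subst2_linear by (simp only: distrib_left add_diff_cancel_left' add_diff_cancel_right')
  \<comment> \<open>The difference quotient of a linear series is its slope. The left side thus
    becomes c times \<phi>(t) + (\<phi>(t+u) - \<phi>(t)).\<close>
  then have q: "?q = ?C"
    using var_t_nonzero mult_right_cancel by blast
  have "subst2 \<phi> var_t * ?C + ?p * (?C * var_u) = ?C * (subst2 \<phi> var_t + ?p * var_u)"
    by (simp add: algebra_simps)
  also have "\<dots> = ?C * subst2 \<phi> (var_t + var_u)"
    by (simp add: exact_quot_mult[OF var_u_dvd var_u_nonzero])
  finally show ?thesis
    unfolding functional_eq_def q unfolding subst2_linear by (simp only: subst2_fps_const_mult)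
qed

lemma functional_eq_linear_left:
  fixes \<psi> :: "'a::idom fps"
  shows "functional_eq (fps_const c * fps_X) \<psi> (fps_const c * \<psi>)"
proof -
  let ?C = "fps_const (fps_const c) :: 'a fps fps"
  let ?p = "exact_quot (subst2 (fps_const c * fps_X) (var_t + var_u)
    - subst2 (fps_const c * fps_X) var_t) (var_u :: 'a fps fps)"
  let ?q = "exact_quot (subst2 \<psi> (var_t + var_u) - subst2 \<psi> var_u) var_t"
  have "?p * var_u = ?C * var_u"
    unfolding exact_quot_mult[OF var_u_dvd var_u_nonzero]
    unfolding subst2_linear by (simp only: distrib_left add_diff_cancel_left' add_diff_cancel_right')
  then have p: "?p = ?C"
    using var_u_nonzero mult_right_cancel by blast
  have "?C * var_t * ?q + ?C * subst2 \<psi> var_u = ?C * (?q * var_t + subst2 \<psi> var_u)"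
    by (simp add: algebra_simps)
  also have "\<dots> = ?C * subst2 \<psi> (var_t + var_u)"
    by (simp add: exact_quot_mult[OF var_t_dvd var_t_nonzero])
  finally show ?thesis
    unfolding functional_eq_def p unfolding subst2_linear by (simp only: subst2_fps_const_mult)
qed

section \<open>Determination of \<rho> and the equivalence\<close>

lemma functional_eq_iff:
  fixes \<phi> :: "'a::field_char_0 fps"
  shows "functional_eq \<phi> \<psi> \<rho> \<and> \<phi> $ 0 * \<psi> $ 0 = 0 \<longleftrightarrow>
    (\<exists>c. \<psi> = fps_const c * fps_X \<and> \<rho> = fps_const c * \<phi>)
    \<or> (\<exists>c. \<phi> = fps_const c * fps_X \<and> \<rho> = fps_const c * \<psi>)"
proof (intro iffI; (elim conjE)?)
  assume eq: "functional_eq \<phi> \<psi> \<rho>" and "\<phi> $ 0 * \<psi> $ 0 = 0"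
  have shift: "fps_shift 1 (fps_const c * fps_X) = fps_const c" for c :: 'a
    by (intro fps_ext) simp
  from eq \<open>\<phi> $ 0 * \<psi> $ 0 = 0\<close>
  show "(\<exists>c. \<psi> = fps_const c * fps_X \<and> \<rho> = fps_const c * \<phi>)
    \<or> (\<exists>c. \<phi> = fps_const c * fps_X \<and> \<rho> = fps_const c * \<psi>)"
  proof (cases rule: functional_eq_linear_cases)
    \<comment> \<open>At u = 0 the derivative term drops out because \<psi>(0) = 0, leaving \<rho> =
      c \<phi>. The other case uses t = 0 in the same way.\<close>
    case (1 c)
    then show ?thesis
      using functional_eq_at_u_0[OF eq] unfolding 1 shift by (auto simp: mult.commute)
  next
    case (2 c)
    then show ?thesis
      using functional_eq_at_t_0[OF eq] unfolding 2 shift by auto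
  qed
next
  assume "(\<exists>c. \<psi> = fps_const c * fps_X \<and> \<rho> = fps_const c * \<phi>)
    \<or> (\<exists>c. \<phi> = fps_const c * fps_X \<and> \<rho> = fps_const c * \<psi>)"
  then show "functional_eq \<phi> \<psi> \<rho> \<and> \<phi> $ 0 * \<psi> $ 0 = 0"
    by (auto simp: functional_eq_linear_left functional_eq_linear_right)
qed

theorem theorem6p2:
  "{(\<phi>, \<psi>, \<rho>) :: 'a::field_char_0 fps \<times> 'a fps \<times> 'a fps | \<phi> \<psi> \<rho>.
      subst2 \<phi> var_t * exact_quot (subst2 \<psi> (var_t + var_u) - subst2 \<psi> var_u) var_t
      + exact_quot (subst2 \<phi> (var_t + var_u) - subst2 \<phi> var_t) var_u * subst2 \<psi> var_u
        = subst2 \<rho> (var_t + var_u)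
      \<and> \<phi> $ 0 * \<psi> $ 0 = 0}
   = {(\<phi>, fps_const c * fps_X, fps_const c * \<phi>) | \<phi> c. True}
     \<union> {(fps_const c * fps_X, \<psi>, fps_const c * \<psi>) | \<psi> c. True}"
  unfolding functional_eq_def[symmetric] functional_eq_iff by auto

end
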